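(* Let $M$ be a $k\times k$ matrix over $\mathbb Z_2$ that is symmetric and idempotent, i.e. $M=M^*=M^2$. Then $M$ is the Gram matrix of a binary Parseval frame (that is, there exist $n\in\mathbb N$ and a binary Parseval frame $\{f_1,\dots,f_k\}$ for $\mathbb Z_2^n$ whose Gram matrix is $M$) if and only if $M$ has at least one odd column.
   Context: $\mathbb Z_2$ is the field with two elements and $\mathbb Z_2^n$ ($n\in\mathbb N=\{1,2,\dots\}$) carries the dot product $(x,y)=\sum_{i=1}^n x_iy_i\in\mathbb Z_2$. A binary Parseval frame for $\mathbb Z_2^n$ is a sequence $\{f_1,\dots,f_k\}$ of vectors in $\mathbb Z_2^n$ (repetitions allowed) such that $x=\sum_{j=1}^k (x,f_j)f_j$ for all $x\in\mathbb Z_2^n$. Its Gram matrix is the $k\times k$ matrix $G$ over $\mathbb Z_2$ with entries $G_{i,j}=(f_j,f_i)$; equivalently $G=\Theta\Theta^*$, where the analysis matrix $\Theta$ is the $k\times n$ matrix whose $i$th row is $f_i$. For a matrix $A$, $A^*$ denotes the transpose. A vector (in particular a column of a matrix) is odd if it has an odd number of non-zero entries, i.e. its entries sum to $1$ in $\mathbb Z_2$, and even otherwise. *)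

theory Defs
  imports "Jordan_Normal_Form.Matrix" "HOL-Library.Z2"
begin

text \<open>
  The field with two elements is \<^typ>\<open>bit\<close>. A finite sequence of vectors is a list, so that
  repetitions are allowed; indices start at 0.
\<close>

definition binary_parseval_frame :: "nat \<Rightarrow> bit vec list \<Rightarrow> bool" where
  "binary_parseval_frame n fs \<longleftrightarrow>
     set fs \<subseteq> carrier_vec n \<and>
     (\<forall>x \<in> carrier_vec n.
        x = finsum_vec TYPE(bit) n (\<lambda>j. (x \<bullet> (fs ! j)) \<cdot>\<^sub>v (fs ! j)) {..<length fs})"

definition gram_matrix :: "bit vec list \<Rightarrow> bit mat" where
  "gram_matrix fs = mat (length fs) (length fs) (\<lambda>(i, j). (fs ! j) \<bullet> (fs ! i))"

definition odd_vec :: "bit vec \<Rightarrow> bool" where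
  "odd_vec v \<longleftrightarrow> odd (card {i. i < dim_vec v \<and> v $ i \<noteq> 0})"

end

theory Submission
  imports Defs
begin

text \<open>
  The parity of a vector is its scalar product with itself, because squaring is the identity on
  the two-element field. For symmetric idempotent \<open>M\<close>, column \<open>j\<close> satisfies
  \<open>M e\<^sub>j \<bullet> M e\<^sub>j = (M\<^sup>2)\<^sub>j\<^sub>j = M\<^sub>j\<^sub>j\<close>, so an odd column is the same as a diagonal entry 1.

  If \<open>M\<close> is the Gram matrix of a frame \<open>f\<close>, then \<open>M\<^sub>j\<^sub>j = f\<^sub>j \<bullet> f\<^sub>j\<close>. These entries cannot all
  vanish: then every \<open>f\<^sub>j\<close> would be even, hence orthogonal to the all-ones vector, and the frame
  could not reconstruct that vector (\<open>parseval_frame_has_odd_vector\<close>).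

  Conversely, a factorization \<open>M = \<Theta> \<Theta>\<^sup>*\<close> with \<open>\<Theta>\<^sup>* \<Theta> = 1\<close> is the same as an orthonormal set \<open>U\<close>
  of columns of \<open>\<Theta>\<close> with \<open>M = \<Sum>\<^sub>u u u\<^sup>*\<close>; the rows of \<open>\<Theta>\<close> then form the frame
  (\<open>frame_of_orthonormal_factorization\<close>). Such a \<open>U\<close> is found as an orthonormal subset of the range
  of \<open>M\<close> of greatest cardinality. An odd column ensures that \<open>U\<close> is nonempty. Let
  \<open>r\<^sub>j = M e\<^sub>j - \<Sum>\<^sub>u u\<^sub>j u\<close> be the columns of the residual matrix \<open>R = M - \<Sum>\<^sub>u u u\<^sup>*\<close>. They lie in
  the range of \<open>M\<close>, are orthogonal to \<open>U\<close>, and \<open>r\<^sub>i \<bullet> r\<^sub>j = R\<^sub>i\<^sub>j\<close>. An odd \<open>r\<^sub>j\<close> could be added to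
  \<open>U\<close>. If all \<open>r\<^sub>j\<close> are even but \<open>R \<noteq> 0\<close>, then some \<open>a = r\<^sub>i\<close> and \<open>b = r\<^sub>j\<close> form a hyperbolic pair;
  such a pair spans no odd vector, but together with any \<open>v \<in> U\<close> it spans a space with the
  orthonormal basis \<open>v + a\<close>, \<open>v + b\<close>, \<open>v + a + b\<close> (\<open>orthonormal_set_replace\<close>), so that \<open>U\<close> could
  again be enlarged. Hence \<open>R = 0\<close> (\<open>orthonormal_factorization_exists\<close>).
\<close>

section \<open>Parity and the scalar product over the two-element field\<close>

text \<open>
  These two simplification rules turn addition and multiplication into bit operations. Without
  them, the laws of fields and of finite sums apply directly.
\<close>

declare add_bit_eq_xor [simp del] mult_bit_eq_and [simp del]

lemma bit_mult_self [simp]: "(b::bit) * b = b"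
  by (cases b) auto

lemma bit_add_self [simp]: "(b::bit) + b = 0"
  by (cases b) auto

lemma scalar_prod_self_eq_sum: "v \<bullet> v = (\<Sum>i<dim_vec v. (v $ i :: bit))"
  by (simp add: scalar_prod_def atLeast0LessThan)

lemma odd_vec_iff_scalar_prod_self: "odd_vec v \<longleftrightarrow> v \<bullet> v = 1"
proof -
  have of_nat: "(of_nat m :: bit) = (if odd m then 1 else 0)" for m
    by (induction m) auto
  have "v \<bullet> v = (\<Sum>i<dim_vec v. if v $ i \<noteq> 0 then 1 else 0)"
    unfolding scalar_prod_self_eq_sum by (rule sum.cong) auto
  also have "\<dots> = of_nat (card {i. i < dim_vec v \<and> v $ i \<noteq> 0})"
    by (simp add: sum.If_cases lessThan_def Int_def)
  finally show ?thesis by (simp add: odd_vec_def of_nat)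
qed

text \<open>
  By symmetry, the left-hand side is the product of row and column \<open>j\<close>, that is, the diagonal
  entry of \<open>M * M\<close>.
\<close>

lemma scalar_prod_self_col:
  assumes "(M :: bit mat) \<in> carrier_mat k k" "M = transpose_mat M" "M = M * M" "j < k"
  shows "col M j \<bullet> col M j = M $$ (j, j)"
proof -
  have "row M j = col M j"
    using assms(1,2,4) by (metis carrier_matD(1) col_transpose)
  moreover have "(M * M) $$ (j, j) = row M j \<bullet> col M j"
    using assms(1,4) by simp
  ultimately show ?thesis using assms(3) by simp
qed

section \<open>A Parseval frame contains an odd vector\<close>

lemma binary_parseval_frame_coordinates:
  assumes "set fs \<subseteq> carrier_vec n"
  shows "binary_parseval_frame n fs \<longleftrightarrow>
    (\<forall>x \<in> carrier_vec n. \<forall>m<n. x $ m = (\<Sum>j<length fs. (x \<bullet> (fs ! j)) * (fs ! j) $ m))"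
proof -
  have in_car: "fs ! j \<in> carrier_vec n" if "j < length fs" for j
    using assms that by auto
  define S where "S x = finsum_vec TYPE(bit) n (\<lambda>j. (x \<bullet> (fs ! j)) \<cdot>\<^sub>v (fs ! j)) {..<length fs}" for x
  have Pi: "(\<lambda>j. (x \<bullet> (fs ! j)) \<cdot>\<^sub>v (fs ! j)) \<in> {..<length fs} \<rightarrow> carrier_vec n" for x
    using in_car by auto
  have S_car: "S x \<in> carrier_vec n" for x
    unfolding S_def by (rule finsum_vec_closed[OF Pi])
  have S_index: "S x $ m = (\<Sum>j<length fs. (x \<bullet> (fs ! j)) * (fs ! j) $ m)" if "m < n" for x m
  proof -
    have "S x $ m = (\<Sum>j<length fs. ((x \<bullet> (fs ! j)) \<cdot>\<^sub>v (fs ! j)) $ m)"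
      unfolding S_def by (rule index_finsum_vec[OF _ that Pi]) simp
    also have "\<dots> = (\<Sum>j<length fs. (x \<bullet> (fs ! j)) * (fs ! j) $ m)"
    proof (rule sum.cong)
      fix j assume "j \<in> {..<length fs}"
      then have "m < dim_vec (fs ! j)" using in_car[of j] that by auto
      then show "((x \<bullet> (fs ! j)) \<cdot>\<^sub>v (fs ! j)) $ m = (x \<bullet> (fs ! j)) * (fs ! j) $ m"
        by (rule index_smult_vec(1))
    qed simp
    finally show ?thesis .
  qed
  have "x = S x \<longleftrightarrow> (\<forall>m<n. x $ m = S x $ m)" if "x \<in> carrier_vec n" for x
    using S_car[of x] that by (auto intro!: eq_vecI)
  then show ?thesis
    unfolding binary_parseval_frame_def S_def[symmetric] using assms S_index by auto
qed

text \<open>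
  The scalar product of the all-ones vector \<open>e\<close> with \<open>f\<close> is the parity of \<open>f\<close>. If every frame
  vector is even, the frame expansion of \<open>e\<close> is therefore zero, although \<open>e \<noteq> 0\<close> as \<open>n \<ge> 1\<close>.
\<close>

lemma parseval_frame_has_odd_vector:
  assumes "1 \<le> n" and frame: "binary_parseval_frame n fs"
  shows "\<exists>f \<in> set fs. f \<bullet> f = 1"
proof (rule ccontr)
  assume "\<not> ?thesis"
  then have even: "f \<bullet> f = 0" if "f \<in> set fs" for f
    using that by (metis bit_not_one_iff)
  have car: "set fs \<subseteq> carrier_vec n"
    using frame by (simp add: binary_parseval_frame_def)
  define e :: "bit vec" where "e = vec n (\<lambda>_. 1)"
  have "e \<bullet> f = 0" if "f \<in> set fs" for f
  proof -
    have "dim_vec f = n" using car that by auto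
    then have "e \<bullet> f = f \<bullet> f"
      unfolding scalar_prod_self_eq_sum by (simp add: e_def scalar_prod_def atLeast0LessThan)
    then show ?thesis using even[OF that] by simp
  qed
  moreover have "e $ 0 = (\<Sum>j<length fs. (e \<bullet> (fs ! j)) * (fs ! j) $ 0)"
    using frame assms(1) by (simp add: binary_parseval_frame_coordinates[OF car] e_def)
  ultimately have "e $ 0 = 0" by simp
  then show False using assms(1) by (simp add: e_def)
qed

section \<open>Enlarging orthonormal sets\<close>

definition orthonormal_set :: "bit vec set \<Rightarrow> bool" where
  "orthonormal_set U \<longleftrightarrow> (\<forall>u\<in>U. \<forall>w\<in>U. u \<bullet> w = (if u = w then 1 else 0))"

lemma finite_carrier_vec_bit: "finite (carrier_vec k :: bit vec set)"
proof -
  have "carrier_vec k \<subseteq> vec_of_list ` {xs :: bit list. set xs \<subseteq> UNIV \<and> length xs = k}"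
  proof
    fix v :: "bit vec" assume "v \<in> carrier_vec k"
    then have "v = vec_of_list (list_of_vec v)" "length (list_of_vec v) = k"
      by (auto simp: vec_list)
    then show "v \<in> vec_of_list ` {xs. set xs \<subseteq> UNIV \<and> length xs = k}" by blast
  qed
  moreover have "finite {xs :: bit list. set xs \<subseteq> UNIV \<and> length xs = k}"
  proof (rule finite_lists_length_eq)
    have "(UNIV :: bit set) = {0, 1}" by (auto intro: bit_not_zero_iff[THEN iffD1])
    then show "finite (UNIV :: bit set)" by (metis finite.emptyI finite_insert)
  qed
  ultimately show ?thesis by (meson finite_surj)
qed

lemma orthonormal_set_insert:
  assumes "orthonormal_set U" "r \<in> carrier_vec k" "U \<subseteq> carrier_vec k"
    and "r \<bullet> r = 1" and orth: "\<And>u. u \<in> U \<Longrightarrow> r \<bullet> u = 0"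
  shows "orthonormal_set (insert r U)" "r \<notin> U"
proof -
  show "r \<notin> U" using orth[of r] assms(4) by auto
  moreover have "u \<bullet> r = 0" if "u \<in> U" for u
    using orth[OF that] comm_scalar_prod[of r k u] assms(2,3) that by auto
  ultimately show "orthonormal_set (insert r U)"
    using assms(1,4) orth by (auto simp: orthonormal_set_def)
qed

text \<open>
  A hyperbolic pair \<open>a, b\<close> orthogonal to \<open>U\<close> contributes no odd vector of its own, since
  \<open>a\<close>, \<open>b\<close> and \<open>a + b\<close> are all even. Adding the odd vector \<open>v\<close> repairs the parity, and
  characteristic 2 makes the three resulting vectors orthogonal: for example
  \<open>(v + a) \<bullet> (v + b) = v \<bullet> v + a \<bullet> b = 1 + 1 = 0\<close>. One vector is thus traded for three.
\<close>

lemma orthonormal_set_replace: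
  assumes U: "orthonormal_set U" "U \<subseteq> carrier_vec k" "v \<in> U"
    and ab: "a \<in> carrier_vec k" "b \<in> carrier_vec k"
    and form: "a \<bullet> a = 0" "b \<bullet> b = 0" "a \<bullet> b = 1"
    and orth: "\<And>u. u \<in> U \<Longrightarrow> a \<bullet> u = 0" "\<And>u. u \<in> U \<Longrightarrow> b \<bullet> u = 0"
  defines "U' \<equiv> insert (v + a) (insert (v + b) (insert (v + a + b) (U - {v})))"
  shows "orthonormal_set U'" "card U < card U'"
proof -
  have vk: "v \<in> carrier_vec k" using U by auto
  have vv: "v \<bullet> v = 1" using U by (auto simp: orthonormal_set_def)
  have ba: "b \<bullet> a = 1" "v \<bullet> a = 0" "v \<bullet> b = 0" "a \<bullet> v = 0" "b \<bullet> v = 0"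
    using form orth[OF U(3)] comm_scalar_prod ab vk by metis+
  note [simp] = add_scalar_prod_distrib[of _ k] scalar_prod_add_distrib[of _ k]
  \<comment> \<open>The three vectors are adjoined one at a time. Orthogonality also yields that each of them is
    new, which gives the cardinality.\<close>
  let ?W = "U - {v}"
  have W: "orthonormal_set ?W" "?W \<subseteq> carrier_vec k"
    using U by (auto simp: orthonormal_set_def)
  have orthW: "v \<bullet> u = 0" "a \<bullet> u = 0" "b \<bullet> u = 0" "u \<in> carrier_vec k" if "u \<in> ?W" for u
    using U orth that by (auto simp: orthonormal_set_def)
  note W1 = orthonormal_set_insert[OF W(1) _ W(2), of "v + a + b"]
  have W1: "orthonormal_set (insert (v + a + b) ?W)" "v + a + b \<notin> ?W"
    by (rule W1; simp add: vk ab orthW vv form ba)+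
  have c1: "insert (v + a + b) ?W \<subseteq> carrier_vec k" using W(2) vk ab by auto
  note W2 = orthonormal_set_insert[OF W1(1) _ c1, of "v + b"]
  have W2: "orthonormal_set (insert (v + b) (insert (v + a + b) ?W))"
    "v + b \<notin> insert (v + a + b) ?W"
    by (rule W2; auto simp add: vk ab orthW vv form ba)+
  have c2: "insert (v + b) (insert (v + a + b) ?W) \<subseteq> carrier_vec k" using c1 vk ab by auto
  note W3 = orthonormal_set_insert[OF W2(1) _ c2, of "v + a"]
  have W3: "orthonormal_set U'" "v + a \<notin> insert (v + b) (insert (v + a + b) ?W)"
    unfolding U'_def by (rule W3; auto simp add: vk ab orthW vv form ba)+
  show "orthonormal_set U'" by (rule W3)
  have "finite U" using finite_carrier_vec_bit U(2) finite_subset by blast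
  moreover from this have "card U = Suc (card ?W)"
    using U(3) by (metis card.remove)
  ultimately show "card U < card U'"
    using W1(2) W2(2) W3(2) by (simp add: U'_def)
qed

section \<open>From an orthonormal factorization to a frame\<close>

text \<open>
  Let \<open>\<Theta>\<close> be the matrix whose columns are the elements of \<open>U\<close> in some order. The assumption on
  \<open>M\<close> says \<open>M = \<Theta> \<Theta>\<^sup>*\<close>, which makes \<open>M\<close> the Gram matrix of the rows of \<open>\<Theta>\<close>, and orthonormality
  says \<open>\<Theta>\<^sup>* \<Theta> = 1\<close>, which is the Parseval identity for these rows.
\<close>

lemma frame_of_orthonormal_factorization:
  assumes "orthonormal_set U" "U \<subseteq> carrier_vec k" "M \<in> carrier_mat k k"
    and factor: "\<And>i j. i < k \<Longrightarrow> j < k \<Longrightarrow> M $$ (i, j) = (\<Sum>u\<in>U. u $ i * u $ j)"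
  shows "\<exists>fs. length fs = k \<and> binary_parseval_frame (card U) fs \<and> gram_matrix fs = M"
proof -
  have "finite U" using finite_carrier_vec_bit assms(2) finite_subset by blast
  then obtain us where us: "set us = U" "distinct us"
    using finite_distinct_list by blast
  define n where "n = length us"
  have n: "card U = n" using us by (auto simp: n_def distinct_card)
  define f where "f i = vec n (\<lambda>l. us ! l $ i)" for i
  have orth: "(\<Sum>j<k. us ! l $ j * us ! m $ j) = (if l = m then 1 else 0)" if "l < n" "m < n" for l m
  proof -
    have "us ! l \<in> U" "us ! m \<in> U" using that us by (auto simp: n_def)
    moreover from this have "dim_vec (us ! m) = k" using assms(2) by auto
    ultimately have "(\<Sum>j<k. us ! l $ j * us ! m $ j) = (if us ! l = us ! m then 1 else 0)"
      using assms(1) unfolding orthonormal_set_def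
      by (metis (no_types, lifting) scalar_prod_def atLeast0LessThan sum.cong)
    then show ?thesis using us(2) that by (simp add: n_def nth_eq_iff_index_eq)
  qed
  have "gram_matrix (map f [0..<k]) = M"
  proof (rule eq_matI)
    show "dim_row (gram_matrix (map f [0..<k])) = dim_row M"
      "dim_col (gram_matrix (map f [0..<k])) = dim_col M"
      using assms(3) by (auto simp: gram_matrix_def)
    fix i j assume "i < dim_row M" "j < dim_col M"
    then have ij: "i < k" "j < k" using assms(3) by auto
    have "gram_matrix (map f [0..<k]) $$ (i, j) = (\<Sum>l<n. us ! l $ i * us ! l $ j)"
      using ij by (simp add: gram_matrix_def f_def scalar_prod_def atLeast0LessThan mult.commute)
    also have "\<dots> = (\<Sum>u\<in>U. u $ i * u $ j)"
      by (rule sum.reindex_bij_betw) (use bij_betw_nth[of us "{..<n}" U] us n_def in simp)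
    finally show "gram_matrix (map f [0..<k]) $$ (i, j) = M $$ (i, j)"
      using factor ij by simp
  qed
  moreover have "binary_parseval_frame n (map f [0..<k])"
  proof (subst binary_parseval_frame_coordinates)
    show "set (map f [0..<k]) \<subseteq> carrier_vec n" by (auto simp: f_def)
    show "\<forall>x\<in>carrier_vec n. \<forall>m<n. x $ m =
      (\<Sum>j<length (map f [0..<k]). x \<bullet> map f [0..<k] ! j * map f [0..<k] ! j $ m)"
    proof (intro ballI allI impI)
      fix x :: "bit vec" and m assume x: "x \<in> carrier_vec n" and m: "m < n"
      have "(\<Sum>j<length (map f [0..<k]). x \<bullet> map f [0..<k] ! j * map f [0..<k] ! j $ m)
        = (\<Sum>j<k. (\<Sum>l<n. x $ l * us ! l $ j) * us ! m $ j)"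
        using m by (simp add: f_def scalar_prod_def atLeast0LessThan)
      also have "\<dots> = (\<Sum>l<n. x $ l * (\<Sum>j<k. us ! l $ j * us ! m $ j))"
        unfolding sum_distrib_left sum_distrib_right
        by (subst sum.swap) (simp add: mult.assoc)
      also have "\<dots> = (\<Sum>l<n. x $ l * (if l = m then 1 else 0))"
        using m by (intro sum.cong) (auto simp: orth)
      also have "\<dots> = (\<Sum>l<n. if l = m then x $ l else 0)"
        by (intro sum.cong) auto
      also have "\<dots> = x $ m" using m by simp
      finally show "x $ m = (\<Sum>j<length (map f [0..<k]). x \<bullet> map f [0..<k] ! j * map f [0..<k] ! j $ m)"
        by simp
    qed
  qed
  ultimately show ?thesis unfolding n by (intro exI[of _ "map f [0..<k]"]) simp
qed

section \<open>Orthonormal factorization of a symmetric idempotent matrix\<close>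

text \<open>
  A greatest orthonormal subset \<open>U\<close> of the range \<open>V\<close> of \<open>M\<close> works: a nonzero residual of \<open>M\<close> would
  provide either an odd vector to add to \<open>U\<close> or a hyperbolic pair that allows one element of \<open>U\<close> to be
  exchanged for three.
  The diagonal entry 1 supplies a first element of \<open>U\<close>, without which the exchange could not start.
\<close>

lemma orthonormal_factorization_exists:
  fixes M :: "bit mat"
  assumes M: "M \<in> carrier_mat k k" and sym: "M = transpose_mat M" and idem: "M = M * M"
    and j0: "j0 < k" "M $$ (j0, j0) = 1"
  obtains U where "orthonormal_set U" "U \<subseteq> carrier_vec k" "U \<noteq> {}"
    "\<And>i j. i < k \<Longrightarrow> j < k \<Longrightarrow> M $$ (i, j) = (\<Sum>u\<in>U. u $ i * u $ j)"
proof -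
  \<comment> \<open>As \<open>M\<close> is idempotent, its range is its set of fixed points.\<close>
  define V where "V = {v \<in> carrier_vec k. M *\<^sub>v v = v}"
  define F where "F U \<longleftrightarrow> U \<subseteq> V \<and> orthonormal_set U" for U
  have V_car: "V \<subseteq> carrier_vec k" by (auto simp: V_def)
  have finV: "finite V" using finite_carrier_vec_bit V_car finite_subset by blast
  have V_add: "x + y \<in> V" if "x \<in> V" "y \<in> V" for x y
    using that M by (auto simp: V_def mult_add_distrib_mat_vec[of M k k])
  have V_index: "(\<Sum>i<k. x $ i * M $$ (i, j)) = x $ j" if "x \<in> V" "j < k" for x j
  proof -
    have x: "dim_vec x = k" using that(1) V_car by auto
    have "x $ j = (M *\<^sub>v x) $ j" using that by (simp add: V_def)
    also have "\<dots> = (\<Sum>i<k. M $$ (j, i) * x $ i)"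
      using that(2) M x by (auto simp: scalar_prod_def atLeast0LessThan)
    also have "\<dots> = (\<Sum>i<k. x $ i * M $$ (i, j))"
      using that(2) M by (subst sym) (auto simp: mult.commute intro!: sum.cong)
    finally show ?thesis ..
  qed
  have V_col: "col M j \<in> V" if "j < k" for j
  proof -
    have "M *\<^sub>v col M j = col (M * M) j" by (rule col_mult2[OF M M that, symmetric])
    also have "\<dots> = col M j" by (rule arg_cong[OF idem[symmetric]])
    finally show ?thesis using M by (auto simp: V_def)
  qed
  have "col M j0 \<bullet> col M j0 = 1"
    by (rule trans[OF scalar_prod_self_col[OF M sym idem j0(1)] j0(2)])
  then have single: "F {col M j0}"
    using V_col[OF j0(1)] by (simp add: F_def orthonormal_set_def)
  have "\<exists>U. F U \<and> (\<forall>U'. F U' \<longrightarrow> card U' \<le> card U)"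
  proof (rule ex_has_greatest_nat[of F, OF single])
    show "\<forall>U. F U \<longrightarrow> card U < Suc (card V)"
      using card_mono[OF finV] by (simp add: F_def less_Suc_eq_le)
  qed
  then obtain U where FU: "F U" and max: "\<And>U'. F U' \<Longrightarrow> card U' \<le> card U" by blast
  have U: "U \<subseteq> V" "orthonormal_set U" "U \<subseteq> carrier_vec k" "finite U"
    using FU V_car finite_subset[OF _ finV] by (auto simp: F_def)
  have "U \<noteq> {}" using max[OF single] by auto
  then obtain v where v: "v \<in> U" by blast
  \<comment> \<open>The columns of the residual matrix; in characteristic 2 the difference is a sum.\<close>
  define r where "r j = vec k (\<lambda>i. M $$ (i, j) + (\<Sum>u\<in>U. u $ i * u $ j))" for j
  have r_car: "r j \<in> carrier_vec k" for j by (simp add: r_def)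
  \<comment> \<open>Every fact about the residual follows from this formula: with a column of \<open>M\<close> for \<open>x\<close> it gives
    membership in \<open>V\<close>, with an element of \<open>U\<close> orthogonality, with \<open>r i\<close> the values of the form.\<close>
  have r_dot: "(\<Sum>i<k. x $ i * r j $ i) = x $ j + (\<Sum>u\<in>U. (x \<bullet> u) * u $ j)"
    if "x \<in> V" "j < k" for x j
  proof -
    have "(\<Sum>i<k. x $ i * r j $ i)
        = (\<Sum>i<k. x $ i * M $$ (i, j)) + (\<Sum>i<k. \<Sum>u\<in>U. x $ i * u $ i * u $ j)"
      by (simp add: r_def distrib_left sum.distrib sum_distrib_left mult.assoc)
    also have "(\<Sum>i<k. \<Sum>u\<in>U. x $ i * u $ i * u $ j) = (\<Sum>u\<in>U. (x \<bullet> u) * u $ j)"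
      using U(3) by (subst sum.swap)
        (auto simp: scalar_prod_def atLeast0LessThan sum_distrib_right intro!: sum.cong)
    finally show ?thesis using V_index that by simp
  qed
  have r_V: "r j \<in> V" if j: "j < k" for j
  proof -
    have "(M *\<^sub>v r j) $ i = r j $ i" if i: "i < k" for i
    proof -
      have "(M *\<^sub>v r j) $ i = (\<Sum>l<k. M $$ (i, l) * r j $ l)"
        using i M r_car[of j] by (auto simp: scalar_prod_def atLeast0LessThan)
      also have "\<dots> = (\<Sum>l<k. col M i $ l * r j $ l)"
        using i M by (subst sym) (auto intro!: sum.cong)
      also have "\<dots> = col M i $ j + (\<Sum>u\<in>U. (col M i \<bullet> u) * u $ j)"
        by (rule r_dot[OF V_col[OF i] j])
      also have "col M i $ j = M $$ (i, j)"
        using i j M by (subst sym) auto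
      also have "(\<Sum>u\<in>U. (col M i \<bullet> u) * u $ j) = (\<Sum>u\<in>U. u $ i * u $ j)"
      proof (rule sum.cong)
        fix u assume u: "u \<in> U"
        then have "dim_vec u = k" using U(3) by auto
        then have "col M i \<bullet> u = (\<Sum>l<k. u $ l * M $$ (l, i))"
          using i M by (auto simp: scalar_prod_def atLeast0LessThan mult.commute intro!: sum.cong)
        then show "col M i \<bullet> u * u $ j = u $ i * u $ j" using V_index i u U(1) by auto
      qed simp
      finally show ?thesis using i by (simp add: r_def)
    qed
    then have "M *\<^sub>v r j = r j"
      using M r_car[of j] by (intro eq_vecI) auto
    then show ?thesis using r_car by (simp add: V_def)
  qed
  have r_orth: "r j \<bullet> u = 0" if "j < k" "u \<in> U" for j u
  proof -
    have "r j \<bullet> u = u \<bullet> r j" using comm_scalar_prod[of "r j" k u] U(3) that r_car by auto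
    also have "\<dots> = (\<Sum>i<k. u $ i * r j $ i)" by (simp add: r_def scalar_prod_def atLeast0LessThan)
    also have "\<dots> = u $ j + (\<Sum>w\<in>U. (u \<bullet> w) * w $ j)" using r_dot U(1) that by auto
    also have "(\<Sum>w\<in>U. (u \<bullet> w) * w $ j) = (\<Sum>w\<in>U. (if u = w then w $ j else 0))"
      using U(2) that by (intro sum.cong) (auto simp: orthonormal_set_def)
    also have "\<dots> = u $ j" using U(4) that by simp
    finally show ?thesis by simp
  qed
  have r_form: "r i \<bullet> r j = r i $ j" if "i < k" "j < k" for i j
  proof -
    have "r i \<bullet> r j = (\<Sum>l<k. r i $ l * r j $ l)" by (simp add: r_def scalar_prod_def atLeast0LessThan)
    also have "\<dots> = r i $ j + (\<Sum>w\<in>U. (r i \<bullet> w) * w $ j)" using r_dot r_V that by auto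
    finally show ?thesis using r_orth that by simp
  qed
  have r_even: "r j \<bullet> r j = 0" if j: "j < k" for j
  proof (rule ccontr)
    assume "r j \<bullet> r j \<noteq> 0"
    then have "r j \<bullet> r j = 1" by simp
    note ins = orthonormal_set_insert[OF U(2) r_car U(3) this r_orth[OF j], simplified]
    have "F (insert (r j) U)" using ins U r_V j by (simp add: F_def)
    from max[OF this] show False using ins(2) U(4) by simp
  qed
  have "r i $ j = 0" if ij: "i < k" "j < k" for i j
  proof (rule ccontr)
    assume "r i $ j \<noteq> 0"
    then have "r i \<bullet> r j = 1" using r_form ij by simp
    note rep = orthonormal_set_replace[OF U(2,3) v r_car r_car r_even[OF ij(1)] r_even[OF ij(2)]
        this r_orth[OF ij(1)] r_orth[OF ij(2)], simplified]
    have "F (insert (v + r i) (insert (v + r j) (insert (v + r i + r j) (U - {v}))))"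
      using rep(1) U(1) v r_V ij V_add by (auto simp: F_def)
    from max[OF this] show False using rep(2) by simp
  qed
  then have r_zero: "r j $ i = 0" if "i < k" "j < k" for i j
    using that by blast
  have "M $$ (i, j) = (\<Sum>u\<in>U. u $ i * u $ j)" if "i < k" "j < k" for i j
  proof -
    have "M $$ (i, j) + (\<Sum>u\<in>U. u $ i * u $ j) = 0"
      using r_zero[OF that] that by (simp add: r_def)
    then show ?thesis by (simp only: add_eq_0_iff2 uminus_bit_def id_apply)
  qed
  then show thesis by (rule that[OF U(2,3) \<open>U \<noteq> {}\<close>])
qed

theorem theorem4p1:
  fixes M :: "bit mat" and k :: nat
  assumes "M \<in> carrier_mat k k"
    and "M = transpose_mat M"
    and "M = M * M"
  shows "(\<exists>n\<ge>1. \<exists>fs. length fs = k \<and> binary_parseval_frame n fs \<and> gram_matrix fs = M)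
         \<longleftrightarrow> (\<exists>j<k. odd_vec (col M j))"
proof -
  have odd_col: "odd_vec (col M j) \<longleftrightarrow> M $$ (j, j) = 1" if "j < k" for j
    using scalar_prod_self_col[OF assms that] by (simp add: odd_vec_iff_scalar_prod_self)
  show ?thesis
  proof
    assume "\<exists>n\<ge>1. \<exists>fs. length fs = k \<and> binary_parseval_frame n fs \<and> gram_matrix fs = M"
    then obtain n fs where n: "1 \<le> n" and fs: "length fs = k" "binary_parseval_frame n fs"
      and gram: "gram_matrix fs = M" by blast
    obtain j where j: "j < k" "fs ! j \<bullet> fs ! j = 1"
      using parseval_frame_has_odd_vector[OF n fs(2)] fs(1) by (metis in_set_conv_nth)
    then have "M $$ (j, j) = 1" using fs(1) gram by (auto simp: gram_matrix_def)
    then show "\<exists>j<k. odd_vec (col M j)" using odd_col j(1) by blast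
  next
    assume "\<exists>j<k. odd_vec (col M j)"
    then obtain j where "j < k" "M $$ (j, j) = 1" using odd_col by blast
    then obtain U where U: "orthonormal_set U" "U \<subseteq> carrier_vec k" "U \<noteq> {}"
      "\<And>i j. i < k \<Longrightarrow> j < k \<Longrightarrow> M $$ (i, j) = (\<Sum>u\<in>U. u $ i * u $ j)"
      using orthonormal_factorization_exists[OF assms] by blast
    have "1 \<le> card U"
      using U(2,3) finite_carrier_vec_bit finite_subset by (metis One_nat_def Suc_leI card_gt_0_iff)
    then show "\<exists>n\<ge>1. \<exists>fs. length fs = k \<and> binary_parseval_frame n fs \<and> gram_matrix fs = M"
      using frame_of_orthonormal_factorization[OF U(1,2) assms(1) U(4)] by blast
  qed
qed

end
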